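(* Let $Q$ be a $Q$-function, $Q(t)=\dfrac{at+b}{t+d}$, and hence a contraction on an interval $I$ containing a fixed point $L$ of $Q$ at which $m=Q'(L)\in(0,1)$. Then for every $t_0\in I$ with $t_0\ne L$, the candidate sequence $$c_n=\frac{|L-Q^{(n)}(t_0)|}{m^n}$$ converges properly (i.e. to a finite nonzero limit), with $$\lim_{n\to\infty}c_n=\left|\frac{(L^2+b)(L-t_0)}{b+Lt_0}\right|.$$
   Context: $Q^{(n)}$ denotes the $n$-fold iterate of $Q$ under composition. A function $f$ is a contraction on an interval $I$ if $f$ is defined on $I$, maps $I$ into $I$, and there is a constant $k<1$ with $|f'(t)|\le k$ for all $t\in I$. Intervals are closed (possibly unbounded). A smooth function $f$ is root-like in an interval $I$ when: (i) $f$ is a contraction on $I$; (ii) $f$ has a fixed point $L$ in the interior of $I$; (iii) $f'(t)>0$ and $f''(t)<0$ for all $t\in I$. Standing assumption for root-like functions: $L>0$. A $Q$-function is a function of the form $Q(t)=\frac{at+b}{t+d}$, with $a,b,d$ real constants, that is root-like (in some interval, around its fixed point $L$). A candidate sequence converges properly if it has a finite nonzero limit. *)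

theory Defs
  imports "HOL-Analysis.Analysis"
begin

text \<open>
  Derivatives at the endpoints of a closed interval \<open>I\<close> are two-sided: a smooth function
  is assumed to be smooth on an open set containing \<open>I\<close>.
\<close>

definition smooth_around :: "(real \<Rightarrow> real) \<Rightarrow> real set \<Rightarrow> bool" where
  "smooth_around f I \<longleftrightarrow>
     (\<exists>U. open U \<and> I \<subseteq> U \<and> (\<forall>n. \<forall>t\<in>U. (deriv ^^ n) f field_differentiable at t))"

definition contraction_on :: "(real \<Rightarrow> real) \<Rightarrow> real set \<Rightarrow> bool" where
  "contraction_on f I \<longleftrightarrow>
     is_interval I \<and> closed I \<and> f ` I \<subseteq> I \<and>
     (\<forall>t\<in>I. f field_differentiable at t) \<and>
     (\<exists>k<1. \<forall>t\<in>I. \<bar>deriv f t\<bar> \<le> k)"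

text \<open>The last conjunct is the standing assumption that the fixed point is positive.\<close>

definition root_like :: "(real \<Rightarrow> real) \<Rightarrow> real set \<Rightarrow> real \<Rightarrow> bool" where
  "root_like f I L \<longleftrightarrow>
     smooth_around f I \<and> contraction_on f I \<and>
     L \<in> interior I \<and> f L = L \<and>
     (\<forall>t\<in>I. deriv f t > 0 \<and> deriv (deriv f) t < 0) \<and>
     L > 0"

text \<open>
  Functions are total here, so that \<open>Q\<close> is defined on \<open>I\<close> is expressed by requiring that
  the pole \<open>-d\<close> is not in \<open>I\<close>; the value of \<open>Q\<close> at the pole is left arbitrary.
\<close>

definition Q_function :: "(real \<Rightarrow> real) \<Rightarrow> real \<Rightarrow> real \<Rightarrow> real \<Rightarrow> bool" where
  "Q_function Q a b d \<longleftrightarrow>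
     (\<forall>t. t \<noteq> - d \<longrightarrow> Q t = (a * t + b) / (t + d)) \<and>
     (\<exists>I L. - d \<notin> I \<and> root_like Q I L)"

definition converges_properly :: "(nat \<Rightarrow> real) \<Rightarrow> bool" where
  "converges_properly c \<longleftrightarrow> (\<exists>l. l \<noteq> 0 \<and> c \<longlonglongrightarrow> l)"

lemma root_like_contraction_fixed_point:
  assumes "root_like f I L"
  shows "contraction_on f I" and "L \<in> I" and "f L = L" and "0 < deriv f L" and "deriv f L < 1"
proof -
  show c: "contraction_on f I" and L: "L \<in> I" and "f L = L" and "0 < deriv f L"
    using assms interior_subset unfolding root_like_def by auto
  show "deriv f L < 1"
    using c L unfolding contraction_on_def by force
qed

lemma Q_function_contraction:
  assumes "Q_function Q a b d"
  obtains I L where "- d \<notin> I" "contraction_on Q I" "L \<in> I" "Q L = L" "deriv Q L \<in> {0<..<1}"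
  using assms root_like_contraction_fixed_point unfolding Q_function_def
  by (metis greaterThanLessThan_iff)

end

theory Submission
  imports Defs
begin

text \<open>
  A \<open>Q\<close>-function is a Moebius map, and a Moebius map with two distinct fixed points \<open>L\<close> and \<open>M\<close> is
  conjugate to a multiplication: in the coordinate \<open>w = (t - L) / (t - M)\<close>, which sends \<open>L\<close> to
  \<open>0\<close> and \<open>M\<close> to infinity, it becomes \<open>w \<mapsto> m * w\<close> with \<open>m = Q' L\<close>
  (\<open>moebius_conjugate_multiplication\<close>). Hence the \<open>n\<close>-th iterate \<open>t\<^sub>n\<close> of \<open>t\<^sub>0\<close> has coordinate
  \<open>m ^ n * w\<^sub>0\<close>, and solving for \<open>t\<^sub>n\<close> gives
  \<open>t\<^sub>n - L = m ^ n * w\<^sub>0 * (L - M) / (1 - m ^ n * w\<^sub>0)\<close>.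
  After division by \<open>m ^ n\<close> the limit \<open>\<bar>w\<^sub>0\<bar> * \<bar>L - M\<bar>\<close> is visible. Vieta's formula
  \<open>L * M = - b\<close> turns it into the stated expression, because \<open>L\<^sup>2 + b = L * (L - M)\<close> and
  \<open>b + L * t\<^sub>0 = L * (t\<^sub>0 - M)\<close>; this rewriting needs \<open>L \<noteq> 0\<close>.

  What remains is to see that the coordinate is finite along the orbit and that \<open>L \<noteq> 0\<close>. Both follow
  from the multipliers at the two fixed points being reciprocal (\<open>moebius_multiplier\<close>). Since
  \<open>Q' M = 1 / m > 1\<close>, the point \<open>M\<close> cannot lie in an interval where \<open>Q\<close> is a contraction, so the
  orbit avoids it; and since \<open>Q\<close> has only one fixed point with multiplier in \<open>(0, 1)\<close>, the point
  \<open>L\<close> is the positive one that makes \<open>Q\<close> root-like.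
\<close>

lemma moebius_minus_fixed_point:
  fixes a b d x t :: "'a::field"
  assumes "x * (x + d) = a * x + b" and "t \<noteq> - d"
  shows "(a * t + b) / (t + d) - x = (a - x) * (t - x) / (t + d)"
proof -
  have "t + d \<noteq> 0"
    using assms(2) by (simp add: add_eq_0_iff2)
  have b: "b = x * (x + d) - a * x"
    using assms(1) by simp
  show ?thesis
    using \<open>t + d \<noteq> 0\<close> unfolding b by (simp add: field_simps)
qed

text \<open>
  The difference quotient of the map at \<open>x\<close> is \<open>(a - x) / (t + d)\<close> by the preceding identity. The
  numerator is \<open>y + d\<close>, where \<open>y = a - d - x\<close> is the other root of the fixed point equation; in
  this form it is apparent that exchanging the two fixed points inverts the multiplier.
\<close>

lemma moebius_multiplier:
  fixes Q :: "real \<Rightarrow> real"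
  assumes Q: "\<And>t. t \<noteq> - d \<Longrightarrow> Q t = (a * t + b) / (t + d)"
    and x: "x \<noteq> - d" "x * (x + d) = a * x + b"
    and y: "x + y = a - d"
  shows "deriv Q x = (y + d) / (x + d)"
proof -
  have xd: "x + d \<noteq> 0"
    using x(1) by linarith
  have b: "b = x * (x + d) - a * x"
    using x(2) by simp
  have y': "y = a - d - x"
    using y by simp
  have "((\<lambda>t. (a * t + b) / (t + d)) has_field_derivative
      (a * (x + d) - (a * x + b)) / ((x + d) * (x + d))) (at x)"
    using xd by (auto intro!: derivative_eq_intros)
  moreover have "(a * (x + d) - (a * x + b)) / ((x + d) * (x + d)) = (y + d) / (x + d)"
  proof -
    have "a * (x + d) - (a * x + b) = (y + d) * (x + d)"
      unfolding b y' by algebra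
    then show ?thesis
      using xd by simp
  qed
  ultimately have "((\<lambda>t. (a * t + b) / (t + d)) has_field_derivative (y + d) / (x + d)) (at x)"
    by simp
  then have "(Q has_field_derivative (y + d) / (x + d)) (at x)"
    by (rule has_field_derivative_transform_within_open[where S = "- {- d}"])
      (use x Q in auto)
  then show ?thesis
    by (rule DERIV_imp_deriv)
qed

text \<open>
  Both differences from a fixed point pick up the same denominator \<open>t + d\<close>, which cancels in the
  quotient.
\<close>

lemma moebius_conjugate_multiplication:
  fixes a b d x y t :: "'a::field"
  assumes x: "x * (x + d) = a * x + b" and y: "y * (y + d) = a * y + b"
    and xy: "x + y = a - d" and t: "t \<noteq> - d"
  shows "((a * t + b) / (t + d) - x) / ((a * t + b) / (t + d) - y)
         = (y + d) / (x + d) * ((t - x) / (t - y))"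
proof -
  have "a - x = y + d" "a - y = x + d"
    using xy by (simp_all add: algebra_simps eq_diff_eq)
  moreover have "t + d \<noteq> 0"
    using t by (simp add: add_eq_0_iff2)
  ultimately show ?thesis
    by (simp add: moebius_minus_fixed_point[OF x t] moebius_minus_fixed_point[OF y t])
qed

lemma fixed_point_equation:
  assumes "Q_function Q a b d" and "x \<noteq> - d" and "Q x = x"
  shows "x * (x + d) = a * x + b"
proof -
  have "x + d \<noteq> 0"
    using assms(2) by linarith
  moreover have "x = (a * x + b) / (x + d)"
    using assms unfolding Q_function_def by metis
  ultimately show ?thesis
    by (metis nonzero_eq_divide_eq)
qed

text \<open>
  Positivity is only given for the fixed point of some root-like interval. That point has a
  multiplier in \<open>(0, 1)\<close>, while the fixed point other than \<open>x\<close> has the reciprocal of such a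
  number as its multiplier, so the positive fixed point must be \<open>x\<close> itself.
\<close>

lemma attracting_fixed_point_positive:
  assumes Q: "Q_function Q a b d"
    and x: "x \<noteq> - d" "Q x = x" and m: "deriv Q x \<in> {0<..<1}"
  shows "0 < x"
proof -
  have Qt: "\<And>t. t \<noteq> - d \<Longrightarrow> Q t = (a * t + b) / (t + d)"
    using Q unfolding Q_function_def by blast
  obtain J z where J: "- d \<notin> J" "root_like Q J z"
    using Q unfolding Q_function_def by blast
  have z: "z \<noteq> - d" "Q z = z" "0 < deriv Q z" "deriv Q z < 1" "0 < z"
    using root_like_contraction_fixed_point[OF J(2)] J unfolding root_like_def by auto
  note fx = fixed_point_equation[OF Q x] and fz = fixed_point_equation[OF Q z(1,2)]
  have "z = x"
  proof (rule ccontr)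
    assume "z \<noteq> x"
    have "(x - z) * (x + z + d - a) = 0"
      using fx fz by algebra
    then have sum: "x + z = a - d" "z + x = a - d"
      using \<open>z \<noteq> x\<close> by auto
    have "deriv Q x * deriv Q z = 1"
      using moebius_multiplier[OF Qt x(1) fx sum(1)] moebius_multiplier[OF Qt z(1) fz sum(2)]
        x(1) z(1) by (simp add: add_eq_0_iff2)
    moreover have "deriv Q x * deriv Q z < 1 * 1"
      by (rule mult_strict_mono) (use m z in auto)
    ultimately show False
      by simp
  qed
  with z show ?thesis
    by simp
qed

theorem theorem3p1:
  fixes Q :: "real \<Rightarrow> real" and a b d L m t0 :: real and I :: "real set" and c :: "nat \<Rightarrow> real"
  assumes "Q_function Q a b d"
    and "- d \<notin> I" and "contraction_on Q I"
    and "L \<in> I" and "Q L = L"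
    and "m = deriv Q L" and "m \<in> {0<..<1}"
    and "t0 \<in> I" and "t0 \<noteq> L"
    and "\<And>n. c n = \<bar>L - (Q ^^ n) t0\<bar> / m ^ n"
  shows "converges_properly c \<and>
         c \<longlonglongrightarrow> \<bar>((L\<^sup>2 + b) * (L - t0)) / (b + L * t0)\<bar>"
proof -
  have Qt: "\<And>t. t \<noteq> - d \<Longrightarrow> Q t = (a * t + b) / (t + d)"
    using assms(1) unfolding Q_function_def by blast
  have Ld: "L \<noteq> - d"
    using assms by auto
  have L: "0 < L"
    using attracting_fixed_point_positive[OF assms(1) Ld \<open>Q L = L\<close>] assms by simp
  note fL = fixed_point_equation[OF assms(1) Ld \<open>Q L = L\<close>]
  define M where "M = a - d - L"
  have sum: "L + M = a - d" "M + L = a - d"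
    unfolding M_def by simp_all
  have b: "b = - (L * M)"
    using fL unfolding M_def by algebra
  have fM: "M * (M + d) = a * M + b"
    unfolding b M_def by algebra
  have m: "m = (M + d) / (L + d)"
    using moebius_multiplier[OF Qt Ld fL sum(1)] assms(6) by simp
  have Md: "M \<noteq> - d" and LM: "L \<noteq> M"
    using m assms(7) Ld by auto
  have "deriv Q M = 1 / m"
    using moebius_multiplier[OF Qt Md fM sum(2)] m by simp
  then have "1 < \<bar>deriv Q M\<bar>"
    using assms(7) by simp
  then have "M \<notin> I"
    using assms(3) unfolding contraction_on_def by force
  have orbit: "(Q ^^ n) t0 \<in> I" for n
    using assms(3,8) unfolding contraction_on_def by (induction n) auto

  define w where "w t = (t - L) / (t - M)" for t
  have w_step: "w (Q t) = m * w t" if "t \<in> I" for t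
  proof -
    have "t \<noteq> - d"
      using that assms(2) by auto
    then show ?thesis
      unfolding w_def m Qt[OF \<open>t \<noteq> - d\<close>]
      by (rule moebius_conjugate_multiplication[OF fL fM sum(1)])
  qed
  have w_orbit: "w ((Q ^^ n) t0) = m ^ n * w t0" for n
    by (induction n) (simp_all add: w_step orbit)
  \<comment> \<open>Inverting the coordinate: \<open>1 - w t = (L - M) / (t - M)\<close>.\<close>
  have w_inv: "t - L = w t * ((L - M) / (1 - w t))" if "t \<in> I" for t
  proof -
    have tM: "t - M \<noteq> 0"
      using that \<open>M \<notin> I\<close> by auto
    then have "1 - w t = (L - M) / (t - M)"
      unfolding w_def by (simp add: field_simps)
    then show ?thesis
      using tM LM by (simp add: w_def)
  qed
  have c: "c n = \<bar>w t0 * ((L - M) / (1 - m ^ n * w t0))\<bar>" for n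
  proof -
    have "\<bar>L - (Q ^^ n) t0\<bar> = \<bar>m ^ n * (w t0 * ((L - M) / (1 - m ^ n * w t0)))\<bar>"
      using w_inv[OF orbit[of n]] unfolding w_orbit
      by (metis abs_minus_commute mult.assoc)
    also have "\<dots> = m ^ n * \<bar>w t0 * ((L - M) / (1 - m ^ n * w t0))\<bar>"
      using assms(7) by (simp add: abs_mult)
    finally show ?thesis
      using assms(7,10) by simp
  qed
  have "(\<lambda>n. \<bar>w t0 * ((L - M) / (1 - m ^ n * w t0))\<bar>) \<longlonglongrightarrow>
      \<bar>w t0 * ((L - M) / (1 - 0 * w t0))\<bar>"
    by (intro tendsto_intros) (use assms(7) in auto)
  then have lim: "c \<longlonglongrightarrow> \<bar>w t0 * (L - M)\<bar>"
    by (simp add: c[abs_def])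

  have t0M: "t0 \<noteq> M"
    using \<open>M \<notin> I\<close> assms(8) by auto
  have "L\<^sup>2 + b = L * (L - M)" "b + L * t0 = L * (t0 - M)"
    unfolding b by (simp_all add: power2_eq_square algebra_simps)
  then have "((L\<^sup>2 + b) * (L - t0)) / (b + L * t0) = (L - M) * (L - t0) / (t0 - M)"
    using L by simp
  also have "\<dots> = - (w t0 * (L - M))"
    unfolding w_def using t0M by (simp add: field_simps)
  finally have limit_eq: "\<bar>((L\<^sup>2 + b) * (L - t0)) / (b + L * t0)\<bar> = \<bar>w t0 * (L - M)\<bar>"
    by simp
  have "\<bar>w t0 * (L - M)\<bar> \<noteq> 0"
    using t0M LM assms(9) unfolding w_def by simp
  with lim show ?thesis
    unfolding converges_properly_def limit_eq by blast
qed

end
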